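(* Let $n\ge 1$ and let $K_n$ be the complete graph on $n$ vertices. For every prime power $q$, the number of invertible Schr\"odinger operators of $K_n$ over $\mathbb F_q$ (i.e. the number of invertible $n\times n$ matrices over $\mathbb F_q$ with all off-diagonal entries equal to $1$ and arbitrary diagonal entries) is $$\frac{(q-1)^{n+1}+(-1)^n}{q}+n(q-1)^{n-1}.$$
   Context: A Schr\"odinger operator of a graph $G$ over a field $\mathbb F$ is a matrix $A+D$ where $A$ is the adjacency matrix of $G$ and $D$ is an arbitrary diagonal matrix over $\mathbb F$. *)

theory Defs
  imports "Jordan_Normal_Form.Determinant" "HOL-Library.Cardinality"
begin

text \<open>
  A simple graph on the vertex set \<open>{0..<n}\<close> is represented by its adjacency relation, a symmetric
  and irreflexive predicate on \<open>nat\<close> of which only the values below \<open>n\<close> matter.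
\<close>

definition complete_graph :: "nat \<Rightarrow> nat \<Rightarrow> bool" where
  "complete_graph i j \<longleftrightarrow> i \<noteq> j"

definition adjacency_mat :: "nat \<Rightarrow> (nat \<Rightarrow> nat \<Rightarrow> bool) \<Rightarrow> 'a :: zero_neq_one mat" where
  "adjacency_mat n E = mat n n (\<lambda>(i, j). if E i j then 1 else 0)"

definition schroedinger_operators :: "nat \<Rightarrow> (nat \<Rightarrow> nat \<Rightarrow> bool) \<Rightarrow> 'a :: field mat set" where
  "schroedinger_operators n E =
     {adjacency_mat n E + D | D. D \<in> carrier_mat n n \<and> diagonal_mat D}"

lemma schroedinger_operators_complete_graph:
  "(schroedinger_operators n complete_graph :: 'a :: field mat set) =
     {M \<in> carrier_mat n n. \<forall>i<n. \<forall>j<n. i \<noteq> j \<longrightarrow> M $$ (i, j) = 1}"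
proof (intro equalityI subsetI)
  fix M :: "'a mat"
  assume "M \<in> schroedinger_operators n complete_graph"
  then show "M \<in> {M \<in> carrier_mat n n. \<forall>i<n. \<forall>j<n. i \<noteq> j \<longrightarrow> M $$ (i, j) = 1}"
    by (auto simp: schroedinger_operators_def adjacency_mat_def complete_graph_def diagonal_mat_def)
next
  fix M :: "'a mat"
  assume M: "M \<in> {M \<in> carrier_mat n n. \<forall>i<n. \<forall>j<n. i \<noteq> j \<longrightarrow> M $$ (i, j) = 1}"
  have "M = adjacency_mat n complete_graph + mat_diag n (\<lambda>i. M $$ (i, i))"
    using M by (intro eq_matI) (auto simp: adjacency_mat_def complete_graph_def mat_diag_def)
  moreover have "diagonal_mat (mat_diag n (\<lambda>i. M $$ (i, i)))"
    by (simp add: diagonal_mat_def mat_diag_def)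
  ultimately show "M \<in> schroedinger_operators n complete_graph"
    unfolding schroedinger_operators_def using mat_diag_dim by blast
qed

end

theory Submission
  imports Defs
begin

text \<open>
  Write an operator as \<open>J + diag x\<close> with \<open>J\<close> the all-ones matrix. A vector \<open>v\<close> with coordinate
  sum \<open>s\<close> lies in its kernel iff \<open>x\<^sub>i v\<^sub>i = -s\<close> for all \<open>i\<close>. Hence the operator is
  singular iff two of the \<open>x\<^sub>i\<close> vanish (take \<open>s = 0\<close>), or none vanishes and the inverses of
  the \<open>x\<^sub>i\<close> sum to \<open>-1\<close> (take \<open>s \<noteq> 0\<close>). The nonzero tuples of length \<open>n + 1\<close> whose
  inverses sum to \<open>c\<close> correspond to the nonzero tuples of length \<open>n\<close> whose inverses do not sum
  to \<open>c\<close>, because the omitted entry is determined; this gives the recursion for their number.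
\<close>

section \<open>Invertibility through the determinant\<close>

lemma invertible_mat_iff_det_nonzero:
  fixes A :: "'a :: field mat"
  assumes A: "A \<in> carrier_mat n n"
  shows "invertible_mat A \<longleftrightarrow> det A \<noteq> 0"
proof
  assume "invertible_mat A"
  then obtain B where AB: "A * B = 1\<^sub>m n" and BA: "B * A = 1\<^sub>m (dim_row B)"
    using A by (auto simp: invertible_mat_def inverts_mat_def)
  \<comment> \<open>\<open>invertible_mat\<close> leaves the dimensions of \<open>B\<close> open;
    comparing column counts in the two products forces \<open>B\<close> to be square of size
    \<open>n\<close>.\<close>
  have "dim_col B = n" using arg_cong[OF AB, of dim_col] by simp
  moreover have "dim_row B = n" using arg_cong[OF BA, of dim_col] A by simp
  ultimately have "B \<in> carrier_mat n n" by auto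
  from det_mult[OF A this] AB have "det A * det B = 1" by simp
  then show "det A \<noteq> 0" by auto
next
  assume "det A \<noteq> 0"
  from det_non_zero_imp_unit[OF A this, of "()"]
  obtain B where "B \<in> carrier_mat n n" "A * B = 1\<^sub>m n" "B * A = 1\<^sub>m n"
    by (auto simp: Units_def ring_mat_def)
  then show "invertible_mat A"
    using A by (auto simp: invertible_mat_def inverts_mat_def)
qed

section \<open>The kernel of the all-ones matrix plus a diagonal matrix\<close>

definition ones_plus_diag :: "'a :: comm_ring_1 list \<Rightarrow> 'a mat" where
  "ones_plus_diag xs =
     mat (length xs) (length xs) (\<lambda>(i, j). if i = j then 1 + xs ! i else 1)"

lemma ones_plus_diag_carrier: "ones_plus_diag xs \<in> carrier_mat (length xs) (length xs)"
  by (simp add: ones_plus_diag_def)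

lemma ones_plus_diag_mult_vec:
  assumes "v \<in> carrier_vec (length xs)" and "i < length xs"
  shows "(ones_plus_diag xs *\<^sub>v v) $ i = xs ! i * v $ i + (\<Sum>j<length xs. v $ j)"
proof -
  have "(ones_plus_diag xs *\<^sub>v v) $ i
      = (\<Sum>j<length xs. (if i = j then 1 + xs ! i else 1) * v $ j)"
    using assms
    by (auto simp: ones_plus_diag_def scalar_prod_def atLeast0LessThan intro!: sum.cong)
  also have "\<dots> = (\<Sum>j<length xs. v $ j + (if j = i then xs ! i * v $ j else 0))"
    by (intro sum.cong) (auto simp: algebra_simps)
  also have "\<dots> = xs ! i * v $ i + (\<Sum>j<length xs. v $ j)"
    using assms(2) by (simp add: sum.distrib add.commute)
  finally show ?thesis .
qed

text \<open>Links the multiplicity used for counting with the pair of distinct positions used in the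
  kernel argument.\<close>

lemma count_list_le_1_iff:
  "count_list xs a \<le> 1 \<longleftrightarrow>
     (\<forall>i<length xs. \<forall>j<length xs. xs ! i = a \<longrightarrow> xs ! j = a \<longrightarrow> i = j)"
proof -
  have "count_list xs a = card {i. i < length xs \<and> a = xs ! i}"
    by (simp add: count_list_eq_length_filter length_filter_conv_card)
  then show ?thesis
    using card_le_Suc0_iff_eq[of "{i. i < length xs \<and> a = xs ! i}"] by auto
qed

lemma sum_list_map_nth: "sum_list (map f xs) = (\<Sum>i<length xs. f (xs ! i))"
  by (simp add: sum_list_sum_nth atLeast0LessThan)

lemma ones_plus_diag_kernel_iff:
  fixes xs :: "'a :: field list"
  assumes "xs \<noteq> []"
  shows "(\<exists>v. v \<in> carrier_vec (length xs) \<and> v \<noteq> 0\<^sub>v (length xs) \<and>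
            ones_plus_diag xs *\<^sub>v v = 0\<^sub>v (length xs)) \<longleftrightarrow>
         \<not> count_list xs 0 \<le> 1 \<or> (0 \<notin> set xs \<and> sum_list (map inverse xs) = -1)"
    (is "?ker \<longleftrightarrow> ?two \<or> ?sum")
proof
  let ?n = "length xs"
  assume ?ker
  then obtain v where v: "v \<in> carrier_vec ?n" "v \<noteq> 0\<^sub>v ?n" "ones_plus_diag xs *\<^sub>v v = 0\<^sub>v ?n"
    by blast
  define s where "s = (\<Sum>j<?n. v $ j)"
  have eq: "xs ! i * v $ i = - s" if "i < ?n" for i
    using ones_plus_diag_mult_vec[OF v(1) that] v(3) that by (simp add: s_def eq_neg_iff_add_eq_0)
  show "?two \<or> ?sum"
  proof (cases "s = 0")
    case True
    obtain i where i: "i < ?n" "v $ i \<noteq> 0"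
      using v(1,2) by (metis carrier_vecD eq_vecI index_zero_vec(1,2))
    \<comment> \<open>A lone nonzero coordinate would equal the coordinate sum \<open>s = 0\<close>,
      so there is a second one. By \<open>eq\<close> both then sit over zero entries of
      \<open>xs\<close>.\<close>
    have "\<exists>j<?n. j \<noteq> i \<and> v $ j \<noteq> 0"
    proof (rule ccontr)
      assume "\<not> ?thesis"
      then have "(\<Sum>j<?n. v $ j) = (\<Sum>j<?n. if j = i then v $ j else 0)"
        by (intro sum.cong) auto
      then show False using True i by (simp add: s_def)
    qed
    then obtain j where j: "j < ?n" "j \<noteq> i" "v $ j \<noteq> 0" by blast
    have "xs ! i = 0" "xs ! j = 0" using eq[OF i(1)] eq[OF j(1)] True i j by auto
    then show ?thesis using i j count_list_le_1_iff[of xs 0] by blast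
  next
    case False
    have nz: "xs ! i \<noteq> 0" if "i < ?n" for i using eq[OF that] False by auto
    have "v $ i = - s * inverse (xs ! i)" if "i < ?n" for i
      using eq[OF that] nz[OF that] by (simp add: field_simps)
    \<comment> \<open>Summing the formula for \<open>v $ i\<close> over all \<open>i\<close> brings
      back \<open>s\<close> on the left; cancelling it leaves the condition on the inverses.\<close>
    then have "s = (\<Sum>i<?n. - s * inverse (xs ! i))"
      by (subst s_def) (intro sum.cong, auto)
    also have "\<dots> = - s * sum_list (map inverse xs)"
      by (simp only: sum_list_map_nth sum_distrib_left)
    finally have "s * sum_list (map inverse xs) = s * (-1)"
      by (metis minus_minus mult_minus1_right mult_minus_left)
    then have "sum_list (map inverse xs) = -1" using False by (simp only: mult_cancel_left) simp
    moreover have "0 \<notin> set xs" using nz by (auto simp: in_set_conv_nth)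
    ultimately show ?thesis by blast
  qed
next
  let ?n = "length xs"
  assume "?two \<or> ?sum"
  then show ?ker
  proof
    assume ?two
    then obtain i j where ij: "i < ?n" "j < ?n" "xs ! i = 0" "xs ! j = 0" "i \<noteq> j"
      using count_list_le_1_iff[of xs 0] by blast
    \<comment> \<open>The difference of two unit vectors has coordinate sum 0 and is supported where
      \<open>xs\<close> vanishes, so both terms of each row are 0.\<close>
    define v where "v = vec ?n (\<lambda>k. (if k = i then 1 else 0) - (if k = j then 1 else 0 :: 'a))"
    have v: "v \<in> carrier_vec ?n" by (simp add: v_def)
    have s: "(\<Sum>k<?n. v $ k) = 0"
      using ij by (simp add: v_def sum_subtractf)
    have "v $ i \<noteq> 0\<^sub>v ?n $ i" using ij by (simp add: v_def)
    then have "v \<noteq> 0\<^sub>v ?n" by metis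
    moreover have "ones_plus_diag xs *\<^sub>v v = 0\<^sub>v ?n"
    proof (rule eq_vecI)
      fix k assume "k < dim_vec (0\<^sub>v ?n :: 'a vec)"
      then show "(ones_plus_diag xs *\<^sub>v v) $ k = 0\<^sub>v ?n $ k"
        using ij by (simp add: ones_plus_diag_mult_vec[OF v] s) (simp add: v_def)
    qed (simp add: ones_plus_diag_def)
    ultimately show ?ker using v by blast
  next
    assume ?sum
    \<comment> \<open>Solves \<open>xs ! k * v $ k = - s\<close> for \<open>s = -1\<close>, which
      the assumption on the inverses makes the actual coordinate sum.\<close>
    define v where "v = vec ?n (\<lambda>k. inverse (xs ! k))"
    have v: "v \<in> carrier_vec ?n" by (simp add: v_def)
    have nz: "xs ! i \<noteq> 0" if "i < ?n" for i using \<open>?sum\<close> that by (metis nth_mem)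
    have s: "(\<Sum>k<?n. v $ k) = -1"
      using \<open>?sum\<close> by (simp add: v_def sum_list_map_nth)
    have "v $ 0 \<noteq> 0\<^sub>v ?n $ 0" using nz[of 0] assms by (simp add: v_def)
    then have "v \<noteq> 0\<^sub>v ?n" by metis
    moreover have "ones_plus_diag xs *\<^sub>v v = 0\<^sub>v ?n"
    proof (rule eq_vecI)
      fix k assume "k < dim_vec (0\<^sub>v ?n :: 'a vec)"
      then show "(ones_plus_diag xs *\<^sub>v v) $ k = 0\<^sub>v ?n $ k"
        using nz[of k] by (simp add: ones_plus_diag_mult_vec[OF v] s) (simp add: v_def)
    qed (simp add: ones_plus_diag_def)
    ultimately show ?ker using v by blast
  qed
qed

text \<open>Negating the kernel criterion allows at most one zero. The split into no zero and
  exactly one zero yields two disjoint families, one for each summand of the final count.\<close>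

lemma invertible_ones_plus_diag_iff:
  fixes xs :: "'a :: field list"
  assumes "xs \<noteq> []"
  shows "invertible_mat (ones_plus_diag xs) \<longleftrightarrow>
           (0 \<notin> set xs \<and> sum_list (map inverse xs) \<noteq> -1) \<or> count_list xs 0 = 1"
proof -
  have "invertible_mat (ones_plus_diag xs) \<longleftrightarrow>
          \<not> (\<not> count_list xs 0 \<le> 1 \<or> (0 \<notin> set xs \<and> sum_list (map inverse xs) = -1))"
    by (simp only: invertible_mat_iff_det_nonzero[OF ones_plus_diag_carrier]
        det_0_iff_vec_prod_zero_field[OF ones_plus_diag_carrier]
        ones_plus_diag_kernel_iff[OF assms])
  then show ?thesis
    using count_list_0_iff[of xs 0] by linarith
qed

section \<open>Parametrisation of the operators by lists\<close>

lemma bij_betw_ones_plus_diag: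
  "bij_betw ones_plus_diag {xs. length xs = n}
     (schroedinger_operators n complete_graph :: 'a :: field mat set)"
  unfolding bij_betw_def
proof
  show "inj_on ones_plus_diag {xs :: 'a list. length xs = n}"
  proof (rule inj_onI)
    fix xs ys :: "'a list"
    assume len: "xs \<in> {xs. length xs = n}" "ys \<in> {xs. length xs = n}"
      and eq: "ones_plus_diag xs = ones_plus_diag ys"
    have "xs ! i = ys ! i" if "i < n" for i
      using arg_cong[OF eq, of "\<lambda>M. M $$ (i, i)"] that len by (simp add: ones_plus_diag_def)
    then show "xs = ys" using len by (simp add: list_eq_iff_nth_eq)
  qed
  show "ones_plus_diag ` {xs :: 'a list. length xs = n} = schroedinger_operators n complete_graph"
    unfolding schroedinger_operators_complete_graph
  proof (intro equalityI subsetI)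
    fix M :: "'a mat"
    assume M: "M \<in> {M \<in> carrier_mat n n. \<forall>i<n. \<forall>j<n. i \<noteq> j \<longrightarrow> M $$ (i, j) = 1}"
    \<comment> \<open>The all-ones matrix contributes 1 to each diagonal entry, hence the
      subtraction. Counting matrices thereby becomes counting lists, where recursion on the length
      is available.\<close>
    have "M = ones_plus_diag (map (\<lambda>i. M $$ (i, i) - 1) [0..<n])"
      using M by (intro eq_matI) (auto simp: ones_plus_diag_def)
    then show "M \<in> ones_plus_diag ` {xs. length xs = n}" by (rule image_eqI) simp
  qed (auto simp: ones_plus_diag_def)
qed

section \<open>Counting lists by zeros and by sums of inverses\<close>

lemma finite_lists_of_length: "finite {xs :: 'a :: finite list. length xs = n}"
  using finite_lists_length_eq[of "UNIV :: 'a set" n] by simp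

lemma card_lists_nonzero:
  "card {xs :: 'a :: {zero, finite} list. length xs = n \<and> 0 \<notin> set xs} = (CARD('a) - 1) ^ n"
proof -
  have "{xs :: 'a list. length xs = n \<and> 0 \<notin> set xs} = {xs. set xs \<subseteq> UNIV - {0} \<and> length xs = n}"
    by auto
  then show ?thesis
    using card_lists_length_eq[of "UNIV - {0 :: 'a}" n] by (simp add: card_Diff_singleton)
qed

lemma card_lists_one_zero:
  "card {xs :: 'a :: {zero, finite} list. length xs = n \<and> count_list xs 0 = 1}
     = n * (CARD('a) - 1) ^ (n - 1)"
proof (induction n)
  case 0
  have "{xs :: 'a list. length xs = 0 \<and> count_list xs 0 = 1} = {}" by auto
  then show ?case by simp
next
  case (Suc n)
  let ?Z = "{xs :: 'a list. length xs = n \<and> 0 \<notin> set xs}"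
  let ?O = "{xs :: 'a list. length xs = n \<and> count_list xs 0 = 1}"
  \<comment> \<open>Split by the head: it is the only zero, or it is nonzero and the tail contains
    the zero.\<close>
  have "{xs :: 'a list. length xs = Suc n \<and> count_list xs 0 = 1}
      = Cons 0 ` ?Z \<union> (\<lambda>(x, xs). x # xs) ` ((UNIV - {0}) \<times> ?O)"
    by (auto simp: length_Suc_conv count_list_0_iff image_iff split: if_splits)
  also have "card \<dots> = card (Cons 0 ` ?Z) + card ((\<lambda>(x, xs). x # xs) ` ((UNIV - {0}) \<times> ?O))"
    by (rule card_Un_disjoint)
      (auto intro!: finite_imageI finite_SigmaI intro: finite_subset[OF _ finite_lists_of_length[of n]])
  also have "card (Cons 0 ` ?Z) = card ?Z" by (rule card_image) simp
  also have "card ((\<lambda>(x, xs). x # xs) ` ((UNIV - {0}) \<times> ?O)) = card ((UNIV - {0 :: 'a}) \<times> ?O)"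
    by (rule card_image) (auto simp: inj_on_def)
  also have "\<dots> = (CARD('a) - 1) * (n * (CARD('a) - 1) ^ (n - 1))"
    by (simp add: card_cartesian_product card_Diff_singleton Suc.IH[simplified])
  \<comment> \<open>The exponent \<open>n - 1\<close> is truncated at \<open>n = 0\<close>, where
    the factor \<open>n\<close> kills that summand; hence the case split.\<close>
  also have "card ?Z + \<dots> = Suc n * (CARD('a) - 1) ^ (Suc n - 1)"
    unfolding card_lists_nonzero by (cases n) (simp_all add: distrib_left)
  finally show ?case .
qed

lemma card_lists_inverse_sum_Suc:
  fixes c :: "'a :: {field, finite}"
  shows "card {xs. length xs = Suc n \<and> 0 \<notin> set xs \<and> sum_list (map inverse xs) = c}
       = card {xs. length xs = n \<and> 0 \<notin> set xs \<and> sum_list (map inverse xs) \<noteq> c}"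
    (is "card ?A = card ?B")
proof -
  \<comment> \<open>The new head must contribute the missing amount to the sum of inverses; it is
    nonzero exactly because the tail does not already sum to \<open>c\<close>.\<close>
  let ?f = "\<lambda>xs. inverse (c - sum_list (map inverse xs)) # xs"
  have "?A = ?f ` ?B"
    by (auto simp: length_Suc_conv image_iff)
  moreover have "inj_on ?f ?B" by (auto simp: inj_on_def)
  ultimately show ?thesis by (simp add: card_image)
qed

text \<open>With N(n) the counted cardinality and q the field size, N(n+1) = (q-1)^(n+1) - N(n). The
  start is N(0) = 1, since the empty sum 0 differs from \<open>c\<close>. Multiplying by q avoids
  division in the induction.\<close>

lemma card_lists_inverse_sum_neq:
  fixes c :: "'a :: {field, finite}"
  assumes "c \<noteq> 0"
  shows "real CARD('a) *
           real (card {xs. length xs = n \<and> 0 \<notin> set xs \<and> sum_list (map inverse xs) \<noteq> c})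
         = (real CARD('a) - 1) ^ (n + 1) + (-1) ^ n"
proof (induction n)
  case 0
  have "{xs :: 'a list. length xs = 0 \<and> 0 \<notin> set xs \<and> sum_list (map inverse xs) \<noteq> c} = {[]}"
    using assms by auto
  then show ?case by simp
next
  case (Suc n)
  let ?E = "\<lambda>m. {xs. length xs = m \<and> 0 \<notin> set xs \<and> sum_list (map inverse xs) = c}"
  let ?N = "\<lambda>m. {xs. length xs = m \<and> 0 \<notin> set xs \<and> sum_list (map inverse xs) \<noteq> c}"
  have "{xs :: 'a list. length xs = Suc n \<and> 0 \<notin> set xs} = ?E (Suc n) \<union> ?N (Suc n)" by auto
  also have "card \<dots> = card (?E (Suc n)) + card (?N (Suc n))"
    by (rule card_Un_disjoint) (auto intro: finite_subset[OF _ finite_lists_of_length[of "Suc n"]])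
  finally have "card (?N n) + card (?N (Suc n)) = (CARD('a) - 1) ^ Suc n"
    by (simp only: card_lists_nonzero card_lists_inverse_sum_Suc)
  moreover have "real CARD('a) - 1 = real (CARD('a) - 1)"
    by (simp add: Suc_leI)
  ultimately have "real (card (?N (Suc n))) = (real CARD('a) - 1) ^ Suc n - real (card (?N n))"
    by (simp only: eq_diff_eq add.commute flip: of_nat_add) (simp only: of_nat_power)
  then have "real CARD('a) * real (card (?N (Suc n)))
      = real CARD('a) * (real CARD('a) - 1) ^ Suc n - real CARD('a) * real (card (?N n))"
    by (simp only: right_diff_distrib)
  then show ?case unfolding Suc.IH by (simp add: algebra_simps)
qed

section \<open>The number of invertible operators\<close>

theorem theorem3:
  fixes n q :: nat
  assumes "n \<ge> 1"
    and "q = CARD('a :: {field, finite})"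
  shows "real (card {M \<in> (schroedinger_operators n complete_graph :: 'a mat set). invertible_mat M}) =
    ((real q - 1) ^ (n + 1) + (-1) ^ n) / real q + real n * (real q - 1) ^ (n - 1)"
proof -
  let ?N = "{xs :: 'a list. length xs = n \<and> 0 \<notin> set xs \<and> sum_list (map inverse xs) \<noteq> -1}"
  let ?O = "{xs :: 'a list. length xs = n \<and> count_list xs 0 = 1}"
  have q: "q > 0" "real (q - 1) = real q - 1"
    using assms(2) by (simp_all add: Suc_leI)
  have inv: "invertible_mat (ones_plus_diag xs) \<longleftrightarrow> xs \<in> ?N \<union> ?O" if "length xs = n" for xs :: "'a list"
    using invertible_ones_plus_diag_iff[of xs] that assms(1) by (cases "xs = []") auto
  have "{M \<in> (schroedinger_operators n complete_graph :: 'a mat set). invertible_mat M}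
      = ones_plus_diag ` (?N \<union> ?O)"
    unfolding bij_betw_imp_surj_on[OF bij_betw_ones_plus_diag, symmetric]
    using inv by (auto simp del: One_nat_def)
  moreover have "inj_on ones_plus_diag (?N \<union> ?O)"
    by (rule inj_on_subset[OF bij_betw_imp_inj_on[OF bij_betw_ones_plus_diag[of n]]]) auto
  ultimately have "card {M \<in> (schroedinger_operators n complete_graph :: 'a mat set). invertible_mat M}
      = card (?N \<union> ?O)"
    by (simp only: card_image)
  \<comment> \<open>Lists in \<open>?N\<close> contain no zero and those in \<open>?O\<close>
    exactly one, so the union is disjoint.\<close>
  also have "\<dots> = card ?N + card ?O"
    by (rule card_Un_disjoint) (auto intro: finite_subset[OF _ finite_lists_of_length[of n]])
  finally show ?thesis
    \<comment> \<open>The target sum -1 is nonzero in every field, so the closed form applies and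
      division by \<open>q\<close> gives the first summand; \<open>?O\<close> gives the
      second.\<close>
    using card_lists_inverse_sum_neq[of "-1 :: 'a" n] q
    by (simp add: card_lists_one_zero[simplified] assms(2)[symmetric] field_simps)
qed

end
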